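(* Let $\mathbf{K}\in\mathbb{R}^{n\times n}$ be symmetric positive semidefinite with rank $r$. Then there exists a matrix $\mathbf{A}\in\mathbb{R}^{n\times r}$ such that $$\mathbf{K}=\mathbf{A}\mathbf{A}^\top.$$ Given such an $\mathbf{A}$, define the feature matrix $\boldsymbol{\phi}:=\mathbf{A}^\top\in\mathbb{R}^{r\times n}$ and let $\boldsymbol{\phi}_i$ denote its $i$th column. Then $$\mathbf{K}=\boldsymbol{\phi}^\top\boldsymbol{\phi},\qquad K_{ij}=\boldsymbol{\phi}_i^\top\boldsymbol{\phi}_j,$$ so $\mathbf{K}$ is the Gram matrix of the feature vectors $\{\boldsymbol{\phi}_i\}_{i=1}^n$, and the dual (feature-space) Gram matrix is $\mathbf{G}:=\boldsymbol{\phi}\boldsymbol{\phi}^\top=\mathbf{A}^\top\mathbf{A}$. Moreover, the finite-dimensional reproducing kernel Hilbert space $\mathcal{H}_{\mathbf{K}}$ induced by $\mathbf{K}$ is $$\mathcal{H}_{\mathbf{K}}=\mathrm{Range}(\mathbf{K})=\mathrm{Range}(\mathbf{A}),\qquad \langle\mathbf{u},\mathbf{v}\rangle_{\mathcal{H}_{\mathbf{K}}}=\mathbf{u}^\top\mathbf{K}^\dagger\mathbf{v}.$$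
   Context: $\mathbf{K}^\dagger$ denotes the Moore–Penrose pseudoinverse. The reproducing kernel Hilbert space (RKHS) induced by $\mathbf{K}$ is the RKHS of the kernel $k(i,j)=K_{ij}$ on the index set $\{1,\dots,n\}$, with functions on this set identified with vectors in $\mathbb{R}^n$: it is the unique Hilbert space of such vectors that contains each column $\mathbf{K}\mathbf{e}_i$ of $\mathbf{K}$ and satisfies the reproducing property $u_i=\langle\mathbf{u},\mathbf{K}\mathbf{e}_i\rangle_{\mathcal{H}_{\mathbf{K}}}$ for all $\mathbf{u}\in\mathcal{H}_{\mathbf{K}}$ and all $i$ (where $\mathbf{e}_i$ is the $i$th standard basis vector). *)

theory Defs
  imports "Jordan_Normal_Form.DL_Rank" Complex_Main
begin

definition symmetric_mat :: "'a mat \<Rightarrow> bool" where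
  "symmetric_mat K \<longleftrightarrow> K\<^sup>T = K"

text \<open>Symmetry is not part of this predicate.\<close>

definition pos_semidef :: "real mat \<Rightarrow> bool" where
  "pos_semidef K \<longleftrightarrow> square_mat K \<and>
     (\<forall>x \<in> carrier_vec (dim_row K). 0 \<le> x \<bullet> (K *\<^sub>v x))"

definition mat_range :: "real mat \<Rightarrow> real vec set" where
  "mat_range M = (\<lambda>x. M *\<^sub>v x) ` carrier_vec (dim_col M)"

definition gram_mat :: "real vec list \<Rightarrow> real mat" where
  "gram_mat vs = mat (length vs) (length vs) (\<lambda>(i, j). vs ! i \<bullet> vs ! j)"

text \<open>The Moore--Penrose pseudoinverse is the unique solution of the four Penrose equations.\<close>

definition is_pinv :: "real mat \<Rightarrow> real mat \<Rightarrow> bool" where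
  "is_pinv M X \<longleftrightarrow> X \<in> carrier_mat (dim_col M) (dim_row M) \<and>
     M * X * M = M \<and> X * M * X = X \<and> (M * X)\<^sup>T = M * X \<and> (X * M)\<^sup>T = X * M"

definition pinv :: "real mat \<Rightarrow> real mat" where
  "pinv M = (THE X. is_pinv M X)"

text \<open>
  A Hilbert space of vectors in \<open>\<real>\<^sup>n\<close> is a linear subspace \<open>H\<close> together with its own inner
  product \<open>ip\<close>, in general different from the standard one. Only the values of \<open>ip\<close> on
  \<open>H \<times> H\<close> are relevant.
\<close>

definition inner_product_on :: "real vec set \<Rightarrow> (real vec \<Rightarrow> real vec \<Rightarrow> real) \<Rightarrow> bool" where
  "inner_product_on H ip \<longleftrightarrow>
     (\<forall>u \<in> H. \<forall>v \<in> H. ip u v = ip v u) \<and>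
     (\<forall>u \<in> H. \<forall>v \<in> H. \<forall>w \<in> H. ip (u + v) w = ip u w + ip v w) \<and>
     (\<forall>c. \<forall>u \<in> H. \<forall>v \<in> H. ip (c \<cdot>\<^sub>v u) v = c * ip u v) \<and>
     (\<forall>u \<in> H. 0 \<le> ip u u) \<and>
     (\<forall>u \<in> H. ip u u = 0 \<longrightarrow> u = 0\<^sub>v (dim_vec u))"

definition ip_dist :: "(real vec \<Rightarrow> real vec \<Rightarrow> real) \<Rightarrow> real vec \<Rightarrow> real vec \<Rightarrow> real" where
  "ip_dist ip u v = sqrt (ip (u - v) (u - v))"

definition ip_complete :: "real vec set \<Rightarrow> (real vec \<Rightarrow> real vec \<Rightarrow> real) \<Rightarrow> bool" where
  "ip_complete H ip \<longleftrightarrow>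
     (\<forall>s :: nat \<Rightarrow> real vec. range s \<subseteq> H \<longrightarrow>
        (\<forall>e > 0. \<exists>N. \<forall>k \<ge> N. \<forall>l \<ge> N. ip_dist ip (s k) (s l) < e) \<longrightarrow>
        (\<exists>u \<in> H. (\<lambda>k. ip_dist ip (s k) u) \<longlonglongrightarrow> 0))"

definition hilbert_space_in :: "nat \<Rightarrow> real vec set \<Rightarrow> (real vec \<Rightarrow> real vec \<Rightarrow> real) \<Rightarrow> bool" where
  "hilbert_space_in n H ip \<longleftrightarrow>
     VectorSpace.subspace class_ring H (module_vec TYPE(real) n) \<and>
     inner_product_on H ip \<and> ip_complete H ip"

text \<open>
  \<open>is_rkhs K H ip\<close>: the pair \<open>(H, ip)\<close> is a reproducing kernel Hilbert space of the kernel
  \<open>(i, j) \<mapsto> K $$ (i, j)\<close> on the index set \<open>{0..<dim_row K}\<close>. The function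
  \<open>k(\<cdot>, i)\<close> is the vector \<open>K *\<^sub>v unit_vec (dim_row K) i\<close>.
\<close>

definition is_rkhs :: "real mat \<Rightarrow> real vec set \<Rightarrow> (real vec \<Rightarrow> real vec \<Rightarrow> real) \<Rightarrow> bool" where
  "is_rkhs K H ip \<longleftrightarrow> hilbert_space_in (dim_row K) H ip \<and>
     (\<forall>i < dim_row K. K *\<^sub>v unit_vec (dim_row K) i \<in> H) \<and>
     (\<forall>u \<in> H. \<forall>i < dim_row K. u $ i = ip u (K *\<^sub>v unit_vec (dim_row K) i))"

end

theory Submission
  imports Defs
begin

text \<open>
  A maximal \<open>K\<close>-orthonormal family, i.e. a matrix \<open>X\<close> with \<open>X\<^sup>T K X = 1\<close> and as many columns as
  possible, gives \<open>K = B B\<^sup>T\<close> for \<open>B = K X\<close>: a vector \<open>K\<close>-orthogonal to all columns of \<open>X\<close> is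
  \<open>K\<close>-null by maximality, hence in the kernel of \<open>K\<close> by semidefiniteness. As \<open>X\<^sup>T B = 1\<close>, the
  number of columns is the rank of \<open>K\<close>, and \<open>K\<^sup>\<dagger>\<close> can be written down from \<open>B\<close>. All claims
  about the RKHS follow from the fact that \<open>K K\<^sup>\<dagger> = K\<^sup>\<dagger> K\<close> is the orthogonal projection onto the
  range of \<open>K\<close>.
\<close>

section \<open>Real scalar products and matrix-vector products\<close>

lemma scalar_prod_self_eq_0_iff:
  fixes v :: "real vec"
  assumes "v \<in> carrier_vec n"
  shows "v \<bullet> v = 0 \<longleftrightarrow> v = 0\<^sub>v n"
proof
  assume "v \<bullet> v = 0"
  then have "\<forall>i\<in>{0..<dim_vec v}. v $ i * v $ i = 0"
    unfolding scalar_prod_def by (subst (asm) sum_nonneg_eq_0_iff) auto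
  then show "v = 0\<^sub>v n" using assms by (intro eq_vecI) auto
qed (use assms in auto)

lemma abs_index_le_sqrt_scalar_prod_self:
  fixes v :: "real vec"
  assumes "i < dim_vec v"
  shows "\<bar>v $ i\<bar> \<le> sqrt (v \<bullet> v)"
proof -
  have "(v $ i)\<^sup>2 \<le> v \<bullet> v"
    unfolding scalar_prod_def power2_eq_square
    using assms by (intro member_le_sum[where f = "\<lambda>i. v $ i * v $ i"]) auto
  then have "sqrt ((v $ i)\<^sup>2) \<le> sqrt (v \<bullet> v)" by (rule real_sqrt_le_mono)
  then show ?thesis by simp
qed

lemma minus_vec_eq_0D:
  fixes u v :: "'a :: group_add vec"
  assumes "u \<in> carrier_vec n" "v \<in> carrier_vec n" "u - v = 0\<^sub>v n"
  shows "u = v"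
proof (rule eq_vecI)
  fix i assume "i < dim_vec v"
  then have "(u - v) $ i = 0" using assms by simp
  then show "u $ i = v $ i" using \<open>i < dim_vec v\<close> by simp
qed (use assms in auto)

lemma mult_mat_vec_scalar_prod:
  fixes A :: "'a :: comm_semiring_0 mat"
  assumes "A \<in> carrier_mat nr nc" "x \<in> carrier_vec nc" "y \<in> carrier_vec nr"
  shows "(A *\<^sub>v x) \<bullet> y = x \<bullet> (A\<^sup>T *\<^sub>v y)"
  using transpose_vec_mult_scalar[of "A\<^sup>T" nc nr y x] assms by simp

lemma mult_mat_unit_vec:
  fixes A :: "'a :: semiring_1 mat"
  assumes "A \<in> carrier_mat nr nc" "i < nc"
  shows "A *\<^sub>v unit_vec nc i = col A i"
  using assms by (intro eq_vecI) auto

lemma eq_mat_mult_vecI: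
  fixes A :: "'a :: semiring_1 mat"
  assumes "A \<in> carrier_mat nr nc" "B \<in> carrier_mat nr nc"
    and "\<And>v. v \<in> carrier_vec nc \<Longrightarrow> A *\<^sub>v v = B *\<^sub>v v"
  shows "A = B"
proof (rule mat_col_eqI)
  fix i assume "i < dim_col B"
  then show "col A i = col B i"
    using assms(3)[of "unit_vec nc i"] mult_mat_unit_vec[of A nr nc i] mult_mat_unit_vec[of B nr nc i] assms
    by auto
qed (use assms in auto)

text \<open>Translates between the matrix equation \<open>X\<^sup>T * (K * X) = 1\<^sub>m m\<close>
  and \<open>K\<close>-orthonormality of the columns of \<open>X\<close>.\<close>

lemma index_congruence_mat:
  fixes K :: "'a :: semiring_0 mat"
  assumes K: "K \<in> carrier_mat n n" and X: "X \<in> carrier_mat n m" and i: "i < m" and j: "j < m"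
  shows "(X\<^sup>T * (K * X)) $$ (i, j) = col X i \<bullet> (K *\<^sub>v col X j)"
proof -
  have "(X\<^sup>T * (K * X)) $$ (i, j) = row X\<^sup>T i \<bullet> col (K * X) j"
    using assms by (intro index_mult_mat(1)) auto
  also have "col (K * X) j = K *\<^sub>v col X j" by (rule col_mult2[OF K X j])
  also have "row X\<^sup>T i = col X i" using X i by simp
  finally show ?thesis .
qed

text \<open>The diagonal of \<open>B * B\<^sup>T\<close> consists of the squared Euclidean norms of
  the rows of \<open>B\<close>.\<close>

lemma mult_transpose_self_eq_0:
  fixes B :: "real mat"
  assumes B: "B \<in> carrier_mat nr nc" and 0: "B * B\<^sup>T = 0\<^sub>m nr nr"
  shows "B = 0\<^sub>m nr nc"
proof (rule eq_rowI)
  fix i assume "i < dim_row (0\<^sub>m nr nc :: real mat)"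
  then have i: "i < nr" by simp
  have "row B i \<bullet> row B i = (B * B\<^sup>T) $$ (i, i)" using B i by simp
  then have "row B i \<bullet> row B i = 0" unfolding 0 using i by simp
  then show "row B i = row (0\<^sub>m nr nc) i"
    using scalar_prod_self_eq_0_iff[of "row B i" nc] B i by auto
qed (use B in auto)

section \<open>Left-invertible matrices and rank\<close>

context vec_space
begin

text \<open>Since \<open>C\<close> recovers \<open>v\<close> from \<open>B *\<^sub>v v\<close>, the
  map of \<open>B\<close> is injective. Distinctness is a separate claim because
  \<open>set (cols B)\<close> forgets repeated columns.\<close>

lemma left_invertible_cols:
  assumes B: "B \<in> carrier_mat n m" and C: "C \<in> carrier_mat m n" and CB: "C * B = 1\<^sub>m m"
  shows "distinct (cols B)" "lin_indpt (set (cols B))"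
proof -
  have inj: "v = C *\<^sub>v (B *\<^sub>v v)" if "v \<in> carrier_vec m" for v
    using that assms assoc_mult_mat_vec[OF C B that] by simp
  show dist: "distinct (cols B)"
    unfolding distinct_conv_nth
  proof (intro allI impI notI)
    fix i j assume ij: "i < length (cols B)" "j < length (cols B)" "i \<noteq> j" "cols B ! i = cols B ! j"
    then have "B *\<^sub>v unit_vec m i = B *\<^sub>v unit_vec m j"
      using B mult_mat_unit_vec[OF B] by simp
    then have "unit_vec m i = (unit_vec m j :: 'a vec)"
      using inj[of "unit_vec m i"] inj[of "unit_vec m j"] by simp
    then show False using ij B by simp
  qed
  show "lin_indpt (set (cols B))"
  proof
    assume "lin_dep (set (cols B))"
    then obtain v where v: "v \<in> carrier_vec m" "v \<noteq> 0\<^sub>v m" "B *\<^sub>v v = 0\<^sub>v n"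
      using lin_depE[OF B _ dist] by blast
    then show False using inj[of v] C by auto
  qed
qed

lemma rank_left_invertible:
  assumes "B \<in> carrier_mat n m" "C \<in> carrier_mat m n" "C * B = 1\<^sub>m m"
  shows "rank B = m"
  using lin_indpt_full_rank left_invertible_cols assms by blast

text \<open>Bounds the size of a \<open>K\<close>-orthonormal family, so that a maximal one
  exists.\<close>

lemma left_invertible_dim_le:
  fixes B C :: "'a mat"
  assumes "B \<in> carrier_mat n m" "C \<in> carrier_mat m n" "C * B = 1\<^sub>m m"
  shows "m \<le> n"
proof -
  have "card (set (cols B)) \<le> dim"
    using left_invertible_cols[OF assms] assms(1) cols_dim[of B] by (intro li_le_dim) auto
  then show ?thesis
    using distinct_card[OF left_invertible_cols(1)[OF assms]] assms(1) dim_is_n by simp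
qed

lemma col_space_mult_subset:
  assumes B: "B \<in> carrier_mat n m" and C: "C \<in> carrier_mat m l"
  shows "col_space (B * C) \<subseteq> col_space B"
proof
  fix y assume "y \<in> col_space (B * C)"
  then obtain x where x: "x \<in> carrier_vec l" "y = B * C *\<^sub>v x"
    using col_space_eq[of "B * C" l] B C by auto
  then show "y \<in> col_space B"
    using col_space_eq[OF B] B C by (auto intro!: bexI[of _ "C *\<^sub>v x"])
qed

text \<open>Each factorization gives one inclusion between the column spaces, and the rank depends
  on the column space only.\<close>

lemma rank_eq_if_mutual_factors:
  assumes "A \<in> carrier_mat n l" "B \<in> carrier_mat n m" "C \<in> carrier_mat m l" "D \<in> carrier_mat l m"
    and "A = B * C" "B = A * D"
  shows "rank A = rank B"
proof -
  have "col_space A = col_space B"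
    using col_space_mult_subset[OF assms(2,3)] col_space_mult_subset[OF assms(1,4)]
    by (intro subset_antisym) (simp_all only: assms(5,6)[symmetric])
  then show ?thesis unfolding rank_def col_space_def by simp
qed

end

section \<open>Full-rank Gram factorization of a semidefinite matrix\<close>

text \<open>With \<open>y = K *\<^sub>v x\<close>, the form at
  \<open>x + t \<cdot>\<^sub>v y\<close> equals \<open>2 * t * a + t\<^sup>2 * b\<close>, where
  \<open>a\<close> is the squared norm of \<open>y\<close>. Were \<open>a\<close> positive, the
  linear term would make this negative for some negative \<open>t\<close>.\<close>

lemma pos_semidef_null_vec:
  assumes K: "K \<in> carrier_mat n n" and sym: "symmetric_mat K" and psd: "pos_semidef K"
    and x: "x \<in> carrier_vec n" and 0: "x \<bullet> (K *\<^sub>v x) = 0"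
  shows "K *\<^sub>v x = 0\<^sub>v n"
proof -
  define y where "y = K *\<^sub>v x"
  define a where "a = y \<bullet> y"
  define b where "b = y \<bullet> (K *\<^sub>v y)"
  have y: "y \<in> carrier_vec n" using K x by (simp add: y_def)
  have Ky: "K *\<^sub>v y \<in> carrier_vec n" using K y by simp
  have b0: "0 \<le> b" using psd K y by (simp add: pos_semidef_def b_def)
  have xKy: "x \<bullet> (K *\<^sub>v y) = a"
    using transpose_vec_mult_scalar[OF K y x] sym by (simp add: symmetric_mat_def y_def[symmetric] a_def)
  have q: "0 \<le> 2 * t * a + t\<^sup>2 * b" for t :: real
  proof -
    have ty: "t \<cdot>\<^sub>v y \<in> carrier_vec n" using y by simp
    have "0 \<le> (x + t \<cdot>\<^sub>v y) \<bullet> (K *\<^sub>v (x + t \<cdot>\<^sub>v y))"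
      using psd K x y by (simp add: pos_semidef_def)
    also have "K *\<^sub>v (x + t \<cdot>\<^sub>v y) = y + t \<cdot>\<^sub>v (K *\<^sub>v y)"
      using mult_add_distrib_mat_vec[OF K x ty] mult_mat_vec[OF K y] by (simp add: y_def)
    also have "(x + t \<cdot>\<^sub>v y) \<bullet> (y + t \<cdot>\<^sub>v (K *\<^sub>v y))
        = x \<bullet> y + t * (x \<bullet> (K *\<^sub>v y)) + t * (y \<bullet> y + t * b)"
      using x y Ky by (simp add: add_scalar_prod_distrib[of _ n] scalar_prod_add_distrib[of _ n] b_def algebra_simps)
    also have "\<dots> = 2 * t * a + t\<^sup>2 * b"
      using 0 xKy by (simp add: y_def[symmetric] a_def[symmetric] power2_eq_square algebra_simps)
    finally show ?thesis .
  qed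
  have "a = 0"
  proof (rule ccontr)
    assume "a \<noteq> 0"
    \<comment> \<open>At \<open>t = - c\<close> the form becomes
      \<open>- (c\<^sup>2 * (b + 2))\<close>. The denominator is \<open>b + 1\<close> because
      \<open>b\<close> may vanish.\<close>
    define c where "c = a / (b + 1)"
    have a: "a = c * (b + 1)" and "c \<noteq> 0" using b0 \<open>a \<noteq> 0\<close> by (auto simp: c_def)
    have "2 * (- c) * a + (- c)\<^sup>2 * b = - (c\<^sup>2 * (b + 2))"
      by (simp add: a algebra_simps power2_eq_square)
    also have "\<dots> < 0" using \<open>c \<noteq> 0\<close> b0 by (simp add: zero_less_mult_iff)
    finally show False using q[of "- c"] by simp
  qed
  then show ?thesis using scalar_prod_self_eq_0_iff[OF y] by (simp add: a_def y_def)
qed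

text \<open>The witness \<open>C\<close>, namely \<open>X\<^sup>T\<close> for the maximal family
  \<open>X\<close>, is kept in the conclusion: as a left inverse it shows that \<open>B\<close> has
  rank \<open>m\<close>, and \<open>B = K * C\<^sup>T\<close> that \<open>K\<close> and
  \<open>B\<close> have the same column space.\<close>

lemma pos_semidef_full_rank_factorization:
  assumes K: "K \<in> carrier_mat n n" and sym: "symmetric_mat K" and psd: "pos_semidef K"
  obtains m B C where "B \<in> carrier_mat n m" "C \<in> carrier_mat m n" "C * B = 1\<^sub>m m"
    "K = B * B\<^sup>T" "B = K * C\<^sup>T"
proof -
  define orth where "orth m X \<longleftrightarrow> X \<in> carrier_mat n m \<and> X\<^sup>T * (K * X) = 1\<^sub>m m" for m X
  have KT: "K\<^sup>T = K" using sym by (simp add: symmetric_mat_def)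
  \<comment> \<open>The empty family is orthonormal. Sizes are bounded by \<open>n\<close>, as
    \<open>X\<^sup>T\<close> is a left inverse of \<open>K * X\<close>, so a greatest size
    \<open>m\<close> exists.\<close>
  have "\<exists>X. orth 0 X"
    by (rule exI[of _ "0\<^sub>m n 0"]) (auto simp: orth_def intro!: eq_matI)
  moreover have "m \<le> n" if "\<exists>X. orth m X" for m
    using that vec_space.left_invertible_dim_le[of "K * X" n m "X\<^sup>T" for X] K
    by (auto simp: orth_def)
  ultimately obtain m where ex: "\<exists>X. orth m X" and max: "\<And>k. \<exists>X. orth k X \<Longrightarrow> k \<le> m"
    using GreatestI_nat[of "\<lambda>m. \<exists>X. orth m X" 0 n] Greatest_le_nat[of "\<lambda>m. \<exists>X. orth m X" _ n]
    by blast
  then obtain X where X: "X \<in> carrier_mat n m" and XKX: "X\<^sup>T * (K * X) = 1\<^sub>m m"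
    by (auto simp: orth_def)
  define B where "B = K * X"
  have B: "B \<in> carrier_mat n m" using K X by (simp add: B_def)
  have BT: "B\<^sup>T = X\<^sup>T * K" using transpose_mult[OF K X] KT by (simp add: B_def)
  have "K *\<^sub>v y = (B * B\<^sup>T) *\<^sub>v y" if y: "y \<in> carrier_vec n" for y
  proof -
    \<comment> \<open>A Gram-Schmidt step: \<open>c\<close> holds the \<open>K\<close>-inner
      products of \<open>y\<close> with the columns of \<open>X\<close>, and \<open>z\<close> is
      what remains of \<open>y\<close> after subtracting its \<open>K\<close>-projection onto their
      span.\<close>
    define c where "c = B\<^sup>T *\<^sub>v y"
    define z where "z = y - X *\<^sub>v c"
    have c: "c \<in> carrier_vec m" using B y by (simp add: c_def)
    have z: "z \<in> carrier_vec n" using X c y by (simp add: z_def)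
    have Kz: "K *\<^sub>v z = K *\<^sub>v y - B *\<^sub>v c"
      using mult_minus_distrib_mat_vec[OF K y, of "X *\<^sub>v c"] assoc_mult_mat_vec[OF K X c] X c
      by (simp add: z_def B_def)
    have Kzc: "K *\<^sub>v z \<in> carrier_vec n" using K z by simp
    have XKz: "X\<^sup>T *\<^sub>v (K *\<^sub>v z) = 0\<^sub>v m"
    proof -
      have "X\<^sup>T *\<^sub>v (K *\<^sub>v z) = X\<^sup>T *\<^sub>v (K *\<^sub>v y) - X\<^sup>T *\<^sub>v (B *\<^sub>v c)"
        unfolding Kz using K X y B c by (intro mult_minus_distrib_mat_vec[of _ _ n]) auto
      also have "X\<^sup>T *\<^sub>v (K *\<^sub>v y) = c"
        unfolding c_def BT using X K y by (intro assoc_mult_mat_vec[symmetric]) auto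
      also have "X\<^sup>T *\<^sub>v (B *\<^sub>v c) = c"
        using assoc_mult_mat_vec[of "X\<^sup>T" m n B m c] X B c XKX by (simp add: B_def)
      finally show ?thesis using c by simp
    qed
    have "z \<bullet> (K *\<^sub>v z) = 0"
    proof (rule ccontr)
      assume "z \<bullet> (K *\<^sub>v z) \<noteq> 0"
      then have pos: "0 < z \<bullet> (K *\<^sub>v z)" using psd K z by (force simp: pos_semidef_def)
      \<comment> \<open>If \<open>z\<close> were not \<open>K\<close>-null, scaling it to
        \<open>K\<close>-norm 1 and appending it to \<open>X\<close> would give a
        \<open>K\<close>-orthonormal family of size \<open>Suc m\<close>.\<close>
      define s where "s = 1 / sqrt (z \<bullet> (K *\<^sub>v z))"
      define w where "w = s \<cdot>\<^sub>v z"
      have w: "w \<in> carrier_vec n" using z by (simp add: w_def)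
      have Kw: "K *\<^sub>v w = s \<cdot>\<^sub>v (K *\<^sub>v z)" using mult_mat_vec[OF K z] by (simp add: w_def)
      have ww: "w \<bullet> (K *\<^sub>v w) = 1"
      proof -
        have "w \<bullet> (K *\<^sub>v w) = s * (s * (z \<bullet> (K *\<^sub>v z)))"
          using z Kzc unfolding Kw by (simp add: w_def)
        also have "\<dots> = 1" using pos by (simp add: s_def)
        finally show ?thesis .
      qed
      have Xw: "col X i \<bullet> (K *\<^sub>v w) = 0" if i: "i < m" for i
      proof -
        have "col X i \<bullet> (K *\<^sub>v z) = (X\<^sup>T *\<^sub>v (K *\<^sub>v z)) $ i" using X i by simp
        then show ?thesis
          using X i Kzc scalar_prod_smult_distrib[of "col X i" n "K *\<^sub>v z" s] unfolding Kw XKz by auto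
      qed
      have wX: "w \<bullet> (K *\<^sub>v col X i) = 0" if i: "i < m" for i
        using Xw[OF i] transpose_vec_mult_scalar[OF K _ w, of "col X i"] X i w KT K
          comm_scalar_prod[of "K *\<^sub>v col X i" n w]
          transpose_vec_mult_scalar[OF K w, of "col X i"] by simp
      have XX: "col X i \<bullet> (K *\<^sub>v col X j) = (if i = j then 1 else 0)" if "i < m" "j < m" for i j
      proof -
        have "col X i \<bullet> (K *\<^sub>v col X j) = (X\<^sup>T * (K * X)) $$ (i, j)"
          using index_congruence_mat[OF K X that] by simp
        then show ?thesis using that by (simp add: XKX)
      qed
      define Y where "Y = mat_of_cols n (cols X @ [w])"
      have Y: "Y \<in> carrier_mat n (Suc m)" using mat_of_cols_carrier(1)[of n "cols X @ [w]"] X by (simp add: Y_def)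
      have colY: "col Y i = (if i < m then col X i else w)" if "i < Suc m" for i
        unfolding Y_def using X w that by (subst col_mat_of_cols) (auto simp: nth_append less_Suc_eq)
      have "Y\<^sup>T * (K * Y) = 1\<^sub>m (Suc m)"
      proof (rule eq_matI)
        fix i j assume "i < dim_row (1\<^sub>m (Suc m) :: real mat)" "j < dim_col (1\<^sub>m (Suc m) :: real mat)"
        then have ij: "i < Suc m" "j < Suc m" by auto
        have "(Y\<^sup>T * (K * Y)) $$ (i, j) = col Y i \<bullet> (K *\<^sub>v col Y j)"
          by (rule index_congruence_mat[OF K Y ij])
        also have "\<dots> = 1\<^sub>m (Suc m) $$ (i, j)"
          unfolding colY[OF ij(1)] colY[OF ij(2)] using ij XX Xw wX ww by auto
        finally show "(Y\<^sup>T * (K * Y)) $$ (i, j) = 1\<^sub>m (Suc m) $$ (i, j)" .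
      qed (use Y K in auto)
      then have "orth (Suc m) Y" using Y by (simp add: orth_def)
      then show False using max[of "Suc m"] by auto
    qed
    then have "K *\<^sub>v y - B *\<^sub>v c = 0\<^sub>v n"
      using pos_semidef_null_vec[OF K sym psd z] by (simp add: Kz)
    then have "K *\<^sub>v y = B *\<^sub>v c" by (rule minus_vec_eq_0D[of _ n, rotated 2]) (use K y B c in simp_all)
    then show ?thesis using assoc_mult_mat_vec[of B n m "B\<^sup>T" n y] B y by (simp add: c_def)
  qed
  then have "K = B * B\<^sup>T" using K B by (intro eq_mat_mult_vecI[of _ n n]) auto
  moreover have "X\<^sup>T \<in> carrier_mat m n" "X\<^sup>T * B = 1\<^sub>m m" "B = K * X\<^sup>T\<^sup>T"
    using X XKX by (simp_all add: B_def)
  ultimately show thesis using that B by blast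
qed

section \<open>The Moore-Penrose pseudoinverse\<close>

text \<open>The symmetric matrices \<open>M * X\<close> and \<open>M * Y\<close> absorb each other,
  so transposing their product shows that they are equal; likewise \<open>X * M\<close> and
  \<open>Y * M\<close>. Then \<open>X = X * M * X = X * M * Y = Y * M * Y = Y\<close>.\<close>

lemma is_pinv_unique:
  assumes X: "is_pinv M X" and Y: "is_pinv M Y"
  shows "X = Y"
proof -
  obtain m n where M: "M \<in> carrier_mat m n" by auto
  have Xc: "X \<in> carrier_mat n m" and Yc: "Y \<in> carrier_mat n m"
    using X Y M by (auto simp: is_pinv_def)
  have MX: "M * X \<in> carrier_mat m m" and MY: "M * Y \<in> carrier_mat m m"
    and XM: "X * M \<in> carrier_mat n n" and YM: "Y * M \<in> carrier_mat n n"
    using M Xc Yc by auto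
  have sym: "(M * X)\<^sup>T = M * X" "(M * Y)\<^sup>T = M * Y" "(X * M)\<^sup>T = X * M" "(Y * M)\<^sup>T = Y * M"
    and MXM: "M * X * M = M" and MYM: "M * Y * M = M"
    and XMX: "X * M * X = X" and YMY: "Y * M * Y = Y"
    using X Y by (auto simp: is_pinv_def)
  have 1: "M * X = M * Y"
  proof -
    have "M * X = (M * Y) * (M * X)"
      using MYM assoc_mult_mat[OF MY M Xc] by simp
    also have "\<dots> = ((M * X) * (M * Y))\<^sup>T"
      using transpose_mult[OF MX MY] sym by simp
    also have "(M * X) * (M * Y) = M * Y"
      using MXM assoc_mult_mat[OF MX M Yc] by simp
    finally show ?thesis using sym by simp
  qed
  have 2: "X * M = Y * M"
  proof -
    have "X * M = (X * M) * (Y * M)"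
      using MYM assoc_mult_mat[OF Xc M YM] assoc_mult_mat[OF M Yc M] by simp
    also have "\<dots> = ((Y * M) * (X * M))\<^sup>T"
      using transpose_mult[OF YM XM] sym by simp
    also have "(Y * M) * (X * M) = Y * M"
      using MXM assoc_mult_mat[OF Yc M XM] assoc_mult_mat[OF M Xc M] by simp
    finally show ?thesis using sym by simp
  qed
  have "X = X * (M * Y)" using XMX assoc_mult_mat[OF Xc M Xc] 1 by simp
  also have "\<dots> = Y" using YMY assoc_mult_mat[OF Xc M Yc] 2 by simp
  finally show ?thesis .
qed

lemma pinv_eqI: "is_pinv M X \<Longrightarrow> pinv M = X"
  unfolding pinv_def using is_pinv_unique by blast

text \<open>A kernel vector \<open>v\<close> of \<open>B\<^sup>T * B\<close> makes the squared norm
  of \<open>B *\<^sub>v v\<close> vanish, so \<open>v = C *\<^sub>v (B *\<^sub>v v)\<close> is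
  zero.\<close>

lemma gram_invertible:
  fixes B :: "real mat"
  assumes B: "B \<in> carrier_mat n m" and C: "C \<in> carrier_mat m n" and CB: "C * B = 1\<^sub>m m"
  obtains H where "H \<in> carrier_mat m m" "(B\<^sup>T * B) * H = 1\<^sub>m m" "H * (B\<^sup>T * B) = 1\<^sub>m m"
proof -
  have G: "B\<^sup>T * B \<in> carrier_mat m m" using B by simp
  have "det (B\<^sup>T * B) \<noteq> 0"
  proof
    assume "det (B\<^sup>T * B) = 0"
    then obtain v where v: "v \<in> carrier_vec m" "v \<noteq> 0\<^sub>v m" "(B\<^sup>T * B) *\<^sub>v v = 0\<^sub>v m"
      using det_0_iff_vec_prod_zero_field[OF G] by blast
    have Bv: "B *\<^sub>v v \<in> carrier_vec n" using B v by simp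
    have "(B *\<^sub>v v) \<bullet> (B *\<^sub>v v) = v \<bullet> ((B\<^sup>T * B) *\<^sub>v v)"
      using mult_mat_vec_scalar_prod[OF B v(1) Bv] assoc_mult_mat_vec[of "B\<^sup>T" m n B m v] B v(1) by simp
    then have "B *\<^sub>v v = 0\<^sub>v n" using v scalar_prod_self_eq_0_iff[OF Bv] by simp
    then have "v = 0\<^sub>v m" using assoc_mult_mat_vec[OF C B v(1)] CB v(1) C by auto
    then show False using v by simp
  qed
  then have "B\<^sup>T * B \<in> Units (ring_mat TYPE(real) m ())" by (rule det_non_zero_imp_unit[OF G])
  then show thesis using that by (auto simp: Units_def ring_mat_simps)
qed

text \<open>A Gram factor \<open>B\<close> of full column rank gives \<open>K\<^sup>\<dagger> = B (B\<^sup>T B)\<^sup>-\<^sup>2 B\<^sup>T\<close>.\<close>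

lemma is_pinv_pos_semidef:
  assumes K: "K \<in> carrier_mat n n" and sym: "symmetric_mat K" and psd: "pos_semidef K"
  shows "is_pinv K (pinv K)"
proof -
  obtain m B C where B: "B \<in> carrier_mat n m" and C: "C \<in> carrier_mat m n"
    and CB: "C * B = 1\<^sub>m m" and KB: "K = B * B\<^sup>T"
    using pos_semidef_full_rank_factorization[OF assms] by metis
  obtain H where H: "H \<in> carrier_mat m m" and GH: "(B\<^sup>T * B) * H = 1\<^sub>m m" and HG: "H * (B\<^sup>T * B) = 1\<^sub>m m"
    using gram_invertible[OF B C CB] .
  define G where "G = B\<^sup>T * B"
  have G: "G \<in> carrier_mat m m" and BT: "B\<^sup>T \<in> carrier_mat m n" using B by (auto simp: G_def)
  have GT: "G\<^sup>T = G" using transpose_mult[OF BT B] by (simp add: G_def)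
  have GH: "G * H = 1\<^sub>m m" and HG: "H * G = 1\<^sub>m m" using GH HG by (simp_all add: G_def)
  \<comment> \<open>Transposing \<open>G * H = 1\<^sub>m m\<close> makes \<open>H\<^sup>T\<close> a
    left inverse of \<open>G\<close>, and this agrees with the right inverse
    \<open>H\<close>.\<close>
  have HT: "H\<^sup>T = H"
  proof -
    have "H\<^sup>T * G = 1\<^sub>m m" using transpose_mult[OF G H] GH GT by simp
    then have "H\<^sup>T = H\<^sup>T * (G * H)" using H GH by simp
    also have "\<dots> = H\<^sup>T * G * H" using H G by simp
    also have "\<dots> = H" using \<open>H\<^sup>T * G = 1\<^sub>m m\<close> H by simp
    finally show ?thesis .
  qed
  define X where "X = B * (H * (H * B\<^sup>T))"
  \<comment> \<open>\<open>P\<close> is the orthogonal projection onto the range of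
    \<open>B\<close>. Once \<open>K * X\<close> and \<open>X * K\<close> are both \<open>P\<close>,
    the Penrose equations reduce to \<open>P * K = K\<close>, \<open>P * X = X\<close> and the
    symmetry of \<open>P\<close>.\<close>
  define P where "P = B * (H * B\<^sup>T)"
  have X: "X \<in> carrier_mat n n" and P: "P \<in> carrier_mat n n" using B H by (auto simp: X_def P_def)
  have HBT: "H * B\<^sup>T \<in> carrier_mat m n" and HHBT: "H * (H * B\<^sup>T) \<in> carrier_mat m n" using H B by auto
  \<comment> \<open>Rewrite rules for right-nested products: an inner \<open>B\<^sup>T\<close>,
    \<open>B\<close> pair becomes \<open>G\<close>, which then cancels against
    \<open>H\<close>.\<close>
  have absorb: "B\<^sup>T * (B * Z) = G * Z" and cancel: "G * (H * Z) = Z" "H * (G * Z) = Z"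
    if "Z \<in> carrier_mat m n" for Z
    using that B BT G H GH HG assoc_mult_mat[OF BT B that] assoc_mult_mat[OF G H that]
      assoc_mult_mat[OF H G that] by (simp_all add: G_def)
  have KX: "K * X = P"
    using assoc_mult_mat[OF B BT X] absorb[OF HHBT] cancel(1)[OF HBT]
    by (simp add: KB X_def P_def)
  have XK: "X * K = P"
  proof -
    have "X * K = B * (H * (H * (B\<^sup>T * (B * B\<^sup>T))))"
      using assoc_mult_mat[OF B HHBT K] assoc_mult_mat[OF H HBT K] assoc_mult_mat[OF H BT K]
      by (simp add: X_def KB)
    then show ?thesis using absorb[OF BT] cancel(2)[OF BT] by (simp add: P_def)
  qed
  have PT: "P\<^sup>T = P"
    using transpose_mult[OF B HBT] transpose_mult[OF H BT] HT assoc_mult_mat[OF B H BT] by (simp add: P_def)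
  have "P * K = K"
    using assoc_mult_mat[OF B HBT K] assoc_mult_mat[OF H BT K] absorb[OF BT] cancel(2)[OF BT]
    by (simp add: P_def KB)
  moreover have "P * X = X"
    using assoc_mult_mat[OF B HBT X] assoc_mult_mat[OF H BT X] absorb[OF HHBT] cancel[OF HHBT]
    by (simp add: P_def X_def)
  ultimately have "is_pinv K X"
    using K X KX XK PT by (simp add: is_pinv_def)
  then show ?thesis using pinv_eqI by metis
qed

text \<open>Transposing the Penrose equations of a symmetric \<open>K\<close> shows that
  \<open>X\<^sup>T\<close> solves them too, so uniqueness gives \<open>X\<^sup>T = X\<close>.
  Commutation is then the symmetry of \<open>X * K\<close>.\<close>

lemma pinv_symmetric:
  assumes "symmetric_mat K" and X: "is_pinv K X"
  shows "X\<^sup>T = X" "X * K = K * X"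
proof -
  have KT: "K\<^sup>T = K" using assms(1) by (simp add: symmetric_mat_def)
  obtain n m where "K \<in> carrier_mat n m" by auto
  \<comment> \<open>Squareness comes from comparing the dimensions of \<open>K\<close> and its
    transpose.\<close>
  moreover have "n = m" using calculation KT by (metis carrier_matD index_transpose_mat(2))
  ultimately have K: "K \<in> carrier_mat n n" by simp
  have Xc: "X \<in> carrier_mat n n" using X K by (auto simp: is_pinv_def)
  have KXT: "K * X\<^sup>T = X * K" using transpose_mult[OF Xc K] X KT by (simp add: is_pinv_def)
  have XTK: "X\<^sup>T * K = K * X" using transpose_mult[OF K Xc] X KT by (simp add: is_pinv_def)
  have XTc: "X\<^sup>T \<in> carrier_mat n n" using Xc by simp
  have "(K * X * K)\<^sup>T = K * X\<^sup>T * K" "(X * K * X)\<^sup>T = X\<^sup>T * K * X\<^sup>T"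
    using transpose_mult[of "K * X" n n K n] transpose_mult[of "X * K" n n X n] transpose_mult[OF K Xc]
      transpose_mult[OF Xc K] K Xc XTc KT assoc_mult_mat[OF K XTc K] assoc_mult_mat[OF XTc K XTc] by auto
  then have "is_pinv K X\<^sup>T"
    using X K Xc KT KXT XTK by (auto simp: is_pinv_def)
  then show "X\<^sup>T = X" using is_pinv_unique X by blast
  then show "X * K = K * X" using KXT by simp
qed

section \<open>Ranges of matrices as subspaces, and the range of a Gram matrix\<close>

lemma mat_range_iff:
  "M \<in> carrier_mat nr nc \<Longrightarrow> u \<in> mat_range M \<longleftrightarrow> (\<exists>x \<in> carrier_vec nc. u = M *\<^sub>v x)"
  by (auto simp: mat_range_def)

lemma mat_range_carrier: "M \<in> carrier_mat nr nc \<Longrightarrow> mat_range M \<subseteq> carrier_vec nr"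
  by (auto simp: mat_range_def)

lemma mat_range_mult_subset:
  "A \<in> carrier_mat nr n \<Longrightarrow> B \<in> carrier_mat n nc \<Longrightarrow> mat_range (A * B) \<subseteq> mat_range A"
  by (auto simp: mat_range_def)

lemma subspace_mat_range:
  assumes M: "M \<in> carrier_mat n m"
  shows "VectorSpace.subspace class_ring (mat_range M) (module_vec TYPE(real) n)"
proof (intro VectorSpace.subspace.intro vec_vs submodule.intro vec_module)
  show "mat_range M \<subseteq> carrier (module_vec TYPE(real) n)"
    using mat_range_carrier[OF M] by (simp add: module_vec_simps)
next
  fix v w assume "v \<in> mat_range M" "w \<in> mat_range M"
  then obtain x y where "x \<in> carrier_vec m" "y \<in> carrier_vec m" "v = M *\<^sub>v x" "w = M *\<^sub>v y"
    by (auto simp: mat_range_iff[OF M])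
  then show "v \<oplus>\<^bsub>module_vec TYPE(real) n\<^esub> w \<in> mat_range M"
    using mult_add_distrib_mat_vec[OF M]
    by (auto simp: mat_range_iff[OF M] module_vec_simps intro!: bexI[of _ "x + y"])
next
  show "\<zero>\<^bsub>module_vec TYPE(real) n\<^esub> \<in> mat_range M"
    using M by (auto simp: mat_range_iff[OF M] module_vec_simps intro!: bexI[of _ "0\<^sub>v m"])
next
  fix c v assume "v \<in> mat_range M"
  then obtain x where "x \<in> carrier_vec m" "v = M *\<^sub>v x"
    by (auto simp: mat_range_iff[OF M])
  then show "c \<odot>\<^bsub>module_vec TYPE(real) n\<^esub> v \<in> mat_range M"
    using mult_mat_vec[OF M]
    by (auto simp: mat_range_iff[OF M] module_vec_simps intro!: bexI[of _ "c \<cdot>\<^sub>v x"])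
qed

lemma subspace_minus_closed:
  assumes H: "VectorSpace.subspace class_ring H (module_vec TYPE(real) n)" and u: "u \<in> H" and v: "v \<in> H"
  shows "u - v \<in> H"
proof -
  have sub: "submodule class_ring H (module_vec TYPE(real) n)"
    using H by (simp add: VectorSpace.subspace_def)
  have "u \<in> carrier_vec n" "v \<in> carrier_vec n"
    using submodule.subset[OF sub] u v by (auto simp: module_vec_simps)
  then have "u - v = u + (-1) \<cdot>\<^sub>v v" by auto
  moreover have "(-1) \<cdot>\<^sub>v v \<in> H"
    using submodule.smult_closed[OF sub, of "-1" v] v by (simp add: module_vec_simps class_ring_simps)
  ultimately show ?thesis
    using submodule.m_closed[OF sub u] by (simp add: module_vec_simps)
qed

text \<open>The defect \<open>D = A - K K\<^sup>\<dagger> A\<close> satisfies \<open>D D\<^sup>T = 0\<close>.\<close>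

lemma mat_range_gram:
  assumes A: "A \<in> carrier_mat n m" and KA: "K = A * A\<^sup>T" and X: "is_pinv K X"
  shows "mat_range K = mat_range A"
proof
  show "mat_range K \<subseteq> mat_range A"
    using mat_range_mult_subset[OF A, of "A\<^sup>T" n] A by (simp add: KA)
  have K: "K \<in> carrier_mat n n" using A by (simp add: KA)
  have Xc: "X \<in> carrier_mat n n" using X K by (auto simp: is_pinv_def)
  \<comment> \<open>The defect is \<open>Q * A\<close>. Since \<open>Q * K = 0\<^sub>m n n\<close>
    by \<open>K * X * K = K\<close>, the product of the defect with its transpose,
    \<open>Q * K * Q\<^sup>T\<close>, vanishes.\<close>
  define Q where "Q = 1\<^sub>m n - K * X"
  have Q: "Q \<in> carrier_mat n n" using K Xc by (simp add: Q_def minus_carrier_mat)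
  have QA: "Q * A \<in> carrier_mat n m" using Q A by simp
  have "Q * K = 0\<^sub>m n n"
    using minus_mult_distrib_mat[of "1\<^sub>m n" n n "K * X" K n] K Xc X by (simp add: Q_def is_pinv_def)
  moreover have "(Q * A) * (Q * A)\<^sup>T = Q * K * Q\<^sup>T"
    using transpose_mult[OF Q A] assoc_mult_mat[OF Q A, of "A\<^sup>T * Q\<^sup>T" n] assoc_mult_mat[OF A, of "A\<^sup>T" n "Q\<^sup>T" n]
      assoc_mult_mat[OF Q K, of "Q\<^sup>T" n] A Q K by (simp add: KA)
  ultimately have "Q * A = 0\<^sub>m n m"
    using mult_transpose_self_eq_0[OF QA] Q by simp
  moreover have "Q * A = A - K * (X * A)"
    using minus_mult_distrib_mat[of "1\<^sub>m n" n n "K * X" A m] K Xc A assoc_mult_mat[OF K Xc A] by (simp add: Q_def)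
  ultimately have 0: "A - K * (X * A) = 0\<^sub>m n m" by simp
  have "A = K * (X * A)"
  proof (rule eq_matI)
    fix i j assume "i < dim_row (K * (X * A))" "j < dim_col (K * (X * A))"
    then have ij: "i < n" "j < m" using K A by auto
    then have "(A - K * (X * A)) $$ (i, j) = 0" by (simp add: 0)
    then show "A $$ (i, j) = (K * (X * A)) $$ (i, j)" using ij K A by simp
  qed (use K A in auto)
  then show "mat_range A \<subseteq> mat_range K"
    using mat_range_mult_subset[OF K, of "X * A" m] Xc A by simp
qed

section \<open>The reproducing kernel Hilbert space on the range of \<open>K\<close>\<close>

text \<open>\<open>X\<close> enters only through the Penrose equations, so the definite description
  behind the pseudoinverse is never unfolded here.\<close>

locale psd_pinv =
  fixes K X :: "real mat" and n :: nat
  assumes K: "K \<in> carrier_mat n n" and sym: "symmetric_mat K" and psd: "pos_semidef K"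
    and pinv: "is_pinv K X"
begin

definition ip :: "real vec \<Rightarrow> real vec \<Rightarrow> real" where
  "ip u v = u \<bullet> (X *\<^sub>v v)"

lemma X: "X \<in> carrier_mat n n"
  using pinv K by (auto simp: is_pinv_def)

lemma KT: "K\<^sup>T = K"
  using sym by (simp add: symmetric_mat_def)

lemma XT: "X\<^sup>T = X" and XK: "X * K = K * X"
  using pinv_symmetric[OF sym pinv] .

lemma K_adjoint: "x \<in> carrier_vec n \<Longrightarrow> y \<in> carrier_vec n \<Longrightarrow> (K *\<^sub>v x) \<bullet> y = x \<bullet> (K *\<^sub>v y)"
  using mult_mat_vec_scalar_prod[OF K] KT by simp

lemma range_carrier: "u \<in> mat_range K \<Longrightarrow> u \<in> carrier_vec n"
  using mat_range_carrier[OF K] by blast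

lemma K_X_range:
  assumes "u \<in> mat_range K"
  shows "K *\<^sub>v (X *\<^sub>v u) = u"
proof -
  obtain a where a: "a \<in> carrier_vec n" "u = K *\<^sub>v a" using assms mat_range_iff[OF K] by blast
  have "(K * X * K) *\<^sub>v a = u" using pinv a by (simp add: is_pinv_def)
  then show ?thesis
    using assoc_mult_mat_vec[of "K * X" n n K n a] assoc_mult_mat_vec[OF K X, of u] K X a by simp
qed

text \<open>Reduces positivity and definiteness of \<open>ip\<close> to the semidefiniteness of
  \<open>K\<close>, evaluated at \<open>X *\<^sub>v u\<close>.\<close>

lemma ip_self:
  assumes "u \<in> mat_range K"
  shows "ip u u = (X *\<^sub>v u) \<bullet> (K *\<^sub>v (X *\<^sub>v u))"
  using K_X_range[OF assms] comm_scalar_prod[of u n "X *\<^sub>v u"] range_carrier[OF assms] X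
  by (simp add: ip_def)

lemma inner_product_on_range: "inner_product_on (mat_range K) ip"
  unfolding inner_product_on_def
proof (intro conjI ballI allI impI)
  fix u v w and c :: real
  assume uR: "u \<in> mat_range K" and vR: "v \<in> mat_range K"
  have u: "u \<in> carrier_vec n" and v: "v \<in> carrier_vec n" using uR vR range_carrier by auto
  have Xu: "X *\<^sub>v u \<in> carrier_vec n" and Xv: "X *\<^sub>v v \<in> carrier_vec n" using X u v by auto
  show "ip u v = ip v u"
    using mult_mat_vec_scalar_prod[OF X u v] comm_scalar_prod[OF v Xu] by (simp add: ip_def XT)
  show "ip (c \<cdot>\<^sub>v u) v = c * ip u v"
    using u Xv by (simp add: ip_def)
  show "0 \<le> ip u u"
    using psd K Xu ip_self[OF uR] by (simp add: pos_semidef_def)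
  \<comment> \<open>Here \<open>X *\<^sub>v u\<close> is \<open>K\<close>-null, hence in the kernel
    of \<open>K\<close>, and \<open>u = K *\<^sub>v (X *\<^sub>v u)\<close> vanishes.\<close>
  show "u = 0\<^sub>v (dim_vec u)" if "ip u u = 0"
    using pos_semidef_null_vec[OF K sym psd Xu] that ip_self[OF uR] K_X_range[OF uR] u by simp
  assume "w \<in> mat_range K"
  then have Xw: "X *\<^sub>v w \<in> carrier_vec n" using range_carrier X by simp
  show "ip (u + v) w = ip u w + ip v w"
    using add_scalar_prod_distrib[OF u v Xw] by (simp add: ip_def)
qed

text \<open>As \<open>K\<close> and \<open>X\<close> are symmetric and commute, both can be moved
  onto \<open>u\<close>: the left side is entry \<open>i\<close> of
  \<open>K *\<^sub>v (X *\<^sub>v u)\<close>, which is \<open>u\<close> on the range.\<close>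

lemma reproducing:
  assumes "u \<in> mat_range K" and i: "i < n"
  shows "ip u (K *\<^sub>v unit_vec n i) = u $ i"
proof -
  have u: "u \<in> carrier_vec n" using assms range_carrier by auto
  have "X *\<^sub>v (K *\<^sub>v unit_vec n i) = K *\<^sub>v (X *\<^sub>v unit_vec n i)"
    using assoc_mult_mat_vec[OF X K, of "unit_vec n i"] assoc_mult_mat_vec[OF K X, of "unit_vec n i"] XK by simp
  then have "ip u (K *\<^sub>v unit_vec n i) = (K *\<^sub>v u) \<bullet> (X *\<^sub>v unit_vec n i)"
    using K_adjoint[OF u, of "X *\<^sub>v unit_vec n i"] X by (simp add: ip_def)
  also have "\<dots> = (X *\<^sub>v (K *\<^sub>v u)) \<bullet> unit_vec n i"
    using mult_mat_vec_scalar_prod[OF X, of "K *\<^sub>v u" "unit_vec n i"] K u by (simp add: XT)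
  also have "X *\<^sub>v (K *\<^sub>v u) = K *\<^sub>v (X *\<^sub>v u)"
    using assoc_mult_mat_vec[OF X K u] assoc_mult_mat_vec[OF K X u] XK by simp
  finally show ?thesis using K_X_range[OF assms(1)] i u by simp
qed

text \<open>For a Gram factor \<open>B\<close> of \<open>K\<close> the map \<open>u \<mapsto> B\<^sup>T X u\<close> is an isometry into Euclidean space.\<close>

lemma ip_complete_range: "ip_complete (mat_range K) ip"
  unfolding ip_complete_def
proof (intro allI impI)
  fix s :: "nat \<Rightarrow> real vec"
  assume s: "range s \<subseteq> mat_range K"
    and cauchy: "\<forall>e>0. \<exists>N. \<forall>k\<ge>N. \<forall>l\<ge>N. ip_dist ip (s k) (s l) < e"
  obtain m B where B: "B \<in> carrier_mat n m" and KB: "K = B * B\<^sup>T"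
    using pos_semidef_full_rank_factorization[OF K sym psd] by metis
  have BT: "B\<^sup>T \<in> carrier_mat m n" using B by simp
  define z where "z u = B\<^sup>T *\<^sub>v (X *\<^sub>v u)" for u
  have sR: "s k \<in> mat_range K" for k using s by blast
  have sc: "s k \<in> carrier_vec n" for k using sR range_carrier by blast
  have z: "z u \<in> carrier_vec m" if "u \<in> carrier_vec n" for u using that BT X by (simp add: z_def)
  have Bz: "B *\<^sub>v z u = u" if "u \<in> mat_range K" for u
    using assoc_mult_mat_vec[OF B BT, of "X *\<^sub>v u"] K_X_range[OF that] X range_carrier[OF that]
    by (simp add: z_def KB)
  have zz: "z u \<bullet> z u = ip u u" if "u \<in> mat_range K" for u
    using mult_mat_vec_scalar_prod[OF BT _ z, of "X *\<^sub>v u" u] Bz[OF that] X range_carrier[OF that]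
      comm_scalar_prod[of u n "X *\<^sub>v u"]
    by (simp add: ip_def z_def)
  have z_diff: "z (u - v) = z u - z v" if "u \<in> carrier_vec n" "v \<in> carrier_vec n" for u v
    using mult_minus_distrib_mat_vec[OF X that] mult_minus_distrib_mat_vec[OF BT, of "X *\<^sub>v u" "X *\<^sub>v v"] X that
    by (simp add: z_def)
  \<comment> \<open>By the isometry, each coordinate of the image sequence is a real Cauchy
    sequence. The coordinate limits form \<open>y\<close>, and \<open>B *\<^sub>v y\<close> is the
    candidate limit in the range.\<close>
  have coord: "\<bar>z (s k) $ j - z (s l) $ j\<bar> \<le> ip_dist ip (s k) (s l)" if j: "j < m" for j k l
  proof -
    have "s k - s l \<in> mat_range K"
      using subspace_minus_closed[OF subspace_mat_range[OF K]] sR by blast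
    then show ?thesis
      using abs_index_le_sqrt_scalar_prod_self[of j "z (s k - s l)"] zz[of "s k - s l"] z_diff[OF sc sc, of k l] z[OF sc, of k] z[OF sc, of l] j
      by (simp add: ip_dist_def)
  qed
  have "\<exists>L. (\<lambda>k. z (s k) $ j) \<longlonglongrightarrow> L" if j: "j < m" for j
  proof -
    have "Cauchy (\<lambda>k. z (s k) $ j)"
      unfolding Cauchy_def dist_real_def using cauchy coord[OF j] by (meson order_le_less_trans)
    then show ?thesis using real_Cauchy_convergent convergent_def by blast
  qed
  then obtain L where L: "\<And>j. j < m \<Longrightarrow> (\<lambda>k. z (s k) $ j) \<longlonglongrightarrow> L j" by metis
  define y where "y = vec m L"
  define d where "d k = z (s k) - y" for k
  have y: "y \<in> carrier_vec m" by (simp add: y_def)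
  have d: "d k \<in> carrier_vec m" for k using z[OF sc] y by (simp add: d_def)
  have d0: "(\<lambda>k. d k $ j) \<longlonglongrightarrow> 0" if "j < m" for j
    using tendsto_diff[OF L[OF that] tendsto_const[of "L j"]] that y by (simp add: d_def y_def)
  \<comment> \<open>Pulling \<open>ip\<close> back along \<open>B\<close> makes the squared distance
    to \<open>B *\<^sub>v y\<close> a quadratic form in the coordinates of \<open>d k\<close>, which
    all tend to 0.\<close>
  define M where "M = B\<^sup>T * (X * B)"
  have M: "M \<in> carrier_mat m m" using BT X B by (simp add: M_def)
  have dist: "ip_dist ip (s k) (B *\<^sub>v y)
      = sqrt (\<Sum>i<m. d k $ i * (\<Sum>j<m. M $$ (i, j) * d k $ j))" for k
  proof -
    have Bd: "s k - B *\<^sub>v y = B *\<^sub>v d k"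
      using mult_minus_distrib_mat_vec[OF B z[OF sc] y] Bz[OF sR] by (simp add: d_def)
    have "ip (B *\<^sub>v d k) (B *\<^sub>v d k) = d k \<bullet> (M *\<^sub>v d k)"
      using mult_mat_vec_scalar_prod[OF B d, of "X *\<^sub>v (B *\<^sub>v d k)" k] B X BT d
        assoc_mult_mat_vec[OF BT, of "X * B" m "d k"] assoc_mult_mat_vec[OF X B d]
      by (simp add: ip_def M_def)
    also have "\<dots> = (\<Sum>i<m. d k $ i * (\<Sum>j<m. M $$ (i, j) * d k $ j))"
      using M d[of k] by (auto simp: scalar_prod_def lessThan_atLeast0 intro!: sum.cong)
    finally show ?thesis by (simp add: ip_dist_def Bd)
  qed
  \<comment> \<open>The limit keeps the shape of the sequence, with 0 for each coordinate of
    \<open>d k\<close>, so that the limit laws apply term by term.\<close>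
  have "(\<lambda>k. sqrt (\<Sum>i<m. d k $ i * (\<Sum>j<m. M $$ (i, j) * d k $ j)))
      \<longlonglongrightarrow> sqrt (\<Sum>i<m. 0 * (\<Sum>j<m. M $$ (i, j) * 0))"
    by (intro tendsto_real_sqrt tendsto_sum tendsto_mult tendsto_const d0) auto
  moreover have "B *\<^sub>v y \<in> mat_range K"
    using mat_range_gram[OF B KB pinv] mat_range_iff[OF B] y by blast
  ultimately show "\<exists>u\<in>mat_range K. (\<lambda>k. ip_dist ip (s k) u) \<longlonglongrightarrow> 0"
    by (intro bexI[of _ "B *\<^sub>v y"]) (simp_all add: dist)
qed

lemma is_rkhs_range: "is_rkhs K (mat_range K) ip"
  using K subspace_mat_range[OF K] inner_product_on_range ip_complete_range reproducing
  by (auto simp: is_rkhs_def hilbert_space_in_def mat_range_iff[OF K])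

text \<open>For \<open>u \<in> H\<close> the residual \<open>w = u - K X u\<close> lies in \<open>H\<close> and in the kernel of \<open>K\<close>, so the
  reproducing property gives \<open>w \<bullet> w = \<langle>w, K w\<rangle> = 0\<close>.\<close>

lemma rkhs_unique:
  assumes rkhs: "is_rkhs K H h"
  shows "H = mat_range K" "\<And>u v. u \<in> H \<Longrightarrow> v \<in> H \<Longrightarrow> h u v = ip u v"
proof -
  have subsp: "VectorSpace.subspace class_ring H (module_vec TYPE(real) n)"
    and inner: "inner_product_on H h"
    and col: "\<And>i. i < n \<Longrightarrow> K *\<^sub>v unit_vec n i \<in> H"
    and rep: "\<And>u i. u \<in> H \<Longrightarrow> i < n \<Longrightarrow> u $ i = h u (K *\<^sub>v unit_vec n i)"
    using rkhs K by (auto simp: is_rkhs_def hilbert_space_in_def)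
  have sub: "submodule class_ring H (module_vec TYPE(real) n)"
    using subsp by (simp add: VectorSpace.subspace_def)
  have carr: "u \<in> carrier_vec n" if "u \<in> H" for u
    using submodule.subset[OF sub] that by (auto simp: module_vec_simps)
  have add: "u + v \<in> H" if "u \<in> H" "v \<in> H" for u v
    using submodule.m_closed[OF sub that] by (simp add: module_vec_simps)
  have smult: "c \<cdot>\<^sub>v u \<in> H" if "u \<in> H" for c u
    using submodule.smult_closed[OF sub, of c u] that by (simp add: module_vec_simps class_ring_simps)
  have zero: "0\<^sub>v n \<in> H"
    using submodule.zero_closed[OF sub] by (simp add: module_vec_simps)
  have h_sym: "h u v = h v u" if "u \<in> H" "v \<in> H" for u v
    using inner that by (auto simp: inner_product_on_def)
  have h_add: "h u (v + w) = h u v + h u w" if "u \<in> H" "v \<in> H" "w \<in> H" for u v w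
    using inner that h_sym add by (simp add: inner_product_on_def)
  have h_smult: "h u (c \<cdot>\<^sub>v v) = c * h u v" if "u \<in> H" "v \<in> H" for c u v
    using inner that h_sym smult by (simp add: inner_product_on_def)
  have h_zero: "h u (0\<^sub>v n) = 0" if "u \<in> H" for u
  proof -
    have "0 \<cdot>\<^sub>v 0\<^sub>v n = (0\<^sub>v n :: real vec)" by auto
    then show ?thesis using h_smult[OF that zero, of 0] by simp
  qed
  \<comment> \<open>Extends the reproducing property linearly from columns to all vectors
    \<open>K *\<^sub>v a\<close>. The induction runs over truncations of \<open>a\<close> to its
    first \<open>l\<close> entries, adding one column of \<open>K\<close> at a time.\<close>
  have partial: "K *\<^sub>v vec n (\<lambda>i. if i < l then a i else 0) \<in> H \<and>
      (\<forall>u\<in>H. h u (K *\<^sub>v vec n (\<lambda>i. if i < l then a i else 0)) = (\<Sum>i<l. a i * u $ i))"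
    if "l \<le> n" for l a
    using that
  proof (induction l)
    case 0
    have "vec n (\<lambda>i. if i < 0 then a i else 0) = 0\<^sub>v n" by auto
    moreover have "K *\<^sub>v 0\<^sub>v n = 0\<^sub>v n" using K by auto
    ultimately show ?case using zero h_zero by simp
  next
    case (Suc l)
    let ?t = "\<lambda>l. vec n (\<lambda>i. if i < l then a i else 0)"
    have "?t (Suc l) = ?t l + a l \<cdot>\<^sub>v unit_vec n l"
      using Suc.prems by (intro eq_vecI) (auto simp: less_Suc_eq)
    then have "K *\<^sub>v ?t (Suc l) = K *\<^sub>v ?t l + a l \<cdot>\<^sub>v (K *\<^sub>v unit_vec n l)"
      using mult_add_distrib_mat_vec[OF K, of "?t l" "a l \<cdot>\<^sub>v unit_vec n l"]
        mult_mat_vec[OF K, of "unit_vec n l" "a l"] by simp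
    then show ?case
      using Suc add smult col[of l] h_add h_smult rep[of _ l] by simp
  qed
  have K_in: "K *\<^sub>v a \<in> H" and h_K: "\<And>u. u \<in> H \<Longrightarrow> h u (K *\<^sub>v a) = u \<bullet> a" if "a \<in> carrier_vec n" for a
  proof -
    have "vec n (\<lambda>i. if i < n then a $ i else 0) = a" using that by auto
    then have *: "K *\<^sub>v a \<in> H" "\<forall>u\<in>H. h u (K *\<^sub>v a) = (\<Sum>i<n. a $ i * u $ i)"
      using partial[of n "\<lambda>i. a $ i"] by auto
    then show "K *\<^sub>v a \<in> H" by simp
    show "h u (K *\<^sub>v a) = u \<bullet> a" if "u \<in> H" for u
      using * that \<open>a \<in> carrier_vec n\<close>
      by (auto simp: scalar_prod_def lessThan_atLeast0 mult.commute intro!: sum.cong)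
  qed
  have KX: "K *\<^sub>v (X *\<^sub>v u) = u" if uH: "u \<in> H" for u
  proof -
    define w where "w = u - K *\<^sub>v (X *\<^sub>v u)"
    have u: "u \<in> carrier_vec n" using carr[OF uH] .
    have Xu: "X *\<^sub>v u \<in> carrier_vec n" using X u by simp
    have wH: "w \<in> H"
      unfolding w_def using subspace_minus_closed[OF subsp uH K_in[OF Xu]] .
    have w: "w \<in> carrier_vec n" using carr[OF wH] .
    \<comment> \<open>\<open>K\<close> and \<open>X\<close> commute and \<open>K * X\<close> fixes
      \<open>K *\<^sub>v u\<close>, so \<open>K\<close> cannot tell \<open>u\<close> from
      \<open>K *\<^sub>v (X *\<^sub>v u)\<close>.\<close>
    have "K *\<^sub>v (K *\<^sub>v (X *\<^sub>v u)) = K *\<^sub>v (X *\<^sub>v (K *\<^sub>v u))"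
      using assoc_mult_mat_vec[OF X K u] assoc_mult_mat_vec[OF K X u] XK by simp
    also have "\<dots> = K *\<^sub>v u"
      using K_X_range[of "K *\<^sub>v u"] mat_range_iff[OF K] u by blast
    finally have "K *\<^sub>v w = 0\<^sub>v n"
      using mult_minus_distrib_mat_vec[OF K u, of "K *\<^sub>v (X *\<^sub>v u)"] K Xu u by (simp add: w_def)
    then have "w \<bullet> w = 0" using h_K[OF w wH] h_zero[OF wH] by simp
    then have w0: "w = 0\<^sub>v n" using scalar_prod_self_eq_0_iff[OF w] by simp
    show ?thesis
      by (rule minus_vec_eq_0D[OF u _ w0[unfolded w_def], symmetric]) (use K Xu in simp)
  qed
  show "H = mat_range K"
  proof
    show "H \<subseteq> mat_range K"
    proof
      fix u assume "u \<in> H"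
      then have "X *\<^sub>v u \<in> carrier_vec n" "u = K *\<^sub>v (X *\<^sub>v u)" 
        using mult_mat_vec_carrier[OF X carr] KX[symmetric] by blast+
      then show "u \<in> mat_range K" unfolding mat_range_iff[OF K] by (rule bexI[rotated])
    qed
    show "mat_range K \<subseteq> H" using K_in K by (auto simp: mat_range_def)
  qed
  \<comment> \<open>Writing \<open>v\<close> as \<open>K *\<^sub>v (X *\<^sub>v v)\<close> and
    applying the extended reproducing property gives
    \<open>u \<bullet> (X *\<^sub>v v)\<close>.\<close>
  show "h u v = ip u v" if "u \<in> H" "v \<in> H" for u v
    using h_K[of "X *\<^sub>v v" u] KX[OF that(2)] carr[OF that(2)] X that by (simp add: ip_def)
qed

end

theorem theorem3:
  fixes K :: "real mat" and n r :: nat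
  assumes "K \<in> carrier_mat n n"
    and "symmetric_mat K"
    and "pos_semidef K"
    and "vec_space.rank n K = r"
  shows "(\<exists>A \<in> carrier_mat n r. K = A * A\<^sup>T) \<and>
    (\<forall>A \<in> carrier_mat n r. K = A * A\<^sup>T \<longrightarrow>
      (let \<phi> = A\<^sup>T; G = \<phi> * \<phi>\<^sup>T in
         \<phi> \<in> carrier_mat r n \<and>
         K = \<phi>\<^sup>T * \<phi> \<and>
         (\<forall>i < n. \<forall>j < n. K $$ (i, j) = col \<phi> i \<bullet> col \<phi> j) \<and>
         K = gram_mat (cols \<phi>) \<and>
         G = A\<^sup>T * A) \<and>
      mat_range K = mat_range A) \<and>
    is_rkhs K (mat_range K) (\<lambda>u v. u \<bullet> (pinv K *\<^sub>v v)) \<and>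
    (\<forall>H ip. is_rkhs K H ip \<longrightarrow>
       H = mat_range K \<and> (\<forall>u \<in> H. \<forall>v \<in> H. ip u v = u \<bullet> (pinv K *\<^sub>v v)))"
proof (intro conjI ballI allI impI)
  interpret psd_pinv K "pinv K" n
    using assms is_pinv_pos_semidef by unfold_locales auto
  obtain m B C where B: "B \<in> carrier_mat n m" and C: "C \<in> carrier_mat m n" and CB: "C * B = 1\<^sub>m m"
    and KB: "K = B * B\<^sup>T" and BK: "B = K * C\<^sup>T"
    using pos_semidef_full_rank_factorization[OF assms(1-3)] by metis
  \<comment> \<open>\<open>K\<close> and \<open>B\<close> factor through each other, and the left
    inverse \<open>C\<close> makes the rank of \<open>B\<close> its number of columns; hence
    \<open>B\<close> has exactly \<open>r\<close> columns.\<close>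
  have "vec_space.rank n K = vec_space.rank n B"
    using B C by (intro vec_space.rank_eq_if_mutual_factors[OF K B _ _ KB BK]) auto
  then have "r = m"
    using vec_space.rank_left_invertible[OF B C CB] assms(4) by simp
  then show "\<exists>A \<in> carrier_mat n r. K = A * A\<^sup>T" using B KB by blast
  have ip: "ip = (\<lambda>u v. u \<bullet> (pinv K *\<^sub>v v))" by (simp add: ip_def fun_eq_iff)
  show "is_rkhs K (mat_range K) (\<lambda>u v. u \<bullet> (pinv K *\<^sub>v v))"
    using is_rkhs_range by (simp add: ip)
  show "H = mat_range K" if "is_rkhs K H h" for H h
    using rkhs_unique(1)[OF that] .
  show "h u v = u \<bullet> (pinv K *\<^sub>v v)" if "is_rkhs K H h" "u \<in> H" "v \<in> H" for H h u v
    using rkhs_unique(2)[OF that] by (simp add: ip)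
  \<comment> \<open>From here on \<open>A\<close> is an arbitrary Gram factor with \<open>r\<close>
    columns, not the constructed \<open>B\<close>.\<close>
  fix A assume A: "A \<in> carrier_mat n r" and KA: "K = A * A\<^sup>T"
  show "mat_range K = mat_range A" using mat_range_gram[OF A KA pinv] .
  have entry: "K $$ (i, j) = col A\<^sup>T i \<bullet> col A\<^sup>T j" if "i < n" "j < n" for i j
    using A that by (simp add: KA)
  moreover have "K = gram_mat (cols A\<^sup>T)"
    using K A entry by (intro eq_matI) (auto simp: gram_mat_def)
  ultimately show "let \<phi> = A\<^sup>T; G = \<phi> * \<phi>\<^sup>T in
         \<phi> \<in> carrier_mat r n \<and>
         K = \<phi>\<^sup>T * \<phi> \<and>
         (\<forall>i < n. \<forall>j < n. K $$ (i, j) = col \<phi> i \<bullet> col \<phi> j) \<and>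
         K = gram_mat (cols \<phi>) \<and>
         G = A\<^sup>T * A"
    using A KA by (simp add: Let_def)
qed

end
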